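(* Let $G$ be a graph and consider a play of width $w$ constructing $G$. The birth order of the play, i.e. any linear order of $V(G)$ in which vertices born in an earlier birth move precede vertices born in a later birth move, with the vertices within each birth group ordered arbitrarily, is a layout $\pi$ of $G$ of active neighborhood-width $\mathrm{anw}_\pi(G)\le\lfloor w/2\rfloor$.
   Context: All graphs are finite, simple and undirected. Active neighborhood-width of a layout. A layout of $G$ is a linear order $\pi=(v_1,\dots,v_n)$ of $V(G)$; put $P_i=\{v_1,\dots,v_i\}$ for $0\le i\le n$. For $u\in P_i$ let $r_i^\pi(u)=N_G(u)\cap (V(G)\setminus P_i)$. Let $\mathcal A_i^\pi=\{r_i^\pi(u):u\in P_i\}\setminus\{\emptyset\}$. Then $\mathrm{anw}_\pi(G)=\max_i|\mathcal A_i^\pi|$. Sequential cable plays. A configuration on $G$ consists of the set of born vertices, a family $\mathcal L$ of pairwise disjoint nonempty sets of born vertices (the live cables), and a set of already placed edges; initially all are empty. With $\ell=|\mathcal L|$ the number of live cables before a move, the moves are: (i) birth$(S)$: introduces a nonempty set $S$ of fresh (not yet born) vertices of $G$ as one live cable; cost $2\ell+1$. The set $S$ is called a birth group. (ii) fold$(X,Y)$: replaces two distinct live cables $X,Y$ by $X\cup Y$; cost $2\ell-1$. (iii) block$(X,Y)$: places every edge between two distinct live cables $X,Y$; legal when all these pairs are edges of $G$ and at least one has not already been placed; cost $2\ell$. (iv) clique$(X)$: places every edge inside a live cable $X$; legal when $X$ is a clique of $G$ and at least one internal edge has not already been placed; cost $2\ell$. (v) close$(X)$: removes the live cable $X$;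 legal when every edge of $G$ incident with a vertex of $X$ has already been placed; cost $2\ell-1$. A play (a finite sequence of legal moves from the initial configuration) constructs $G$ if every vertex is born, every edge of $G$ is placed, and every cable is closed. The width of a play is the maximum cost of its moves (and $0$ for the empty play on the empty graph). *)

theory Defs
  imports Main
begin

text \<open>A finite simple undirected graph is a finite vertex set \<open>V\<close> together with a set \<open>E\<close> of
  two-element subsets of \<open>V\<close>.\<close>

definition simple_graph :: "'a set \<Rightarrow> 'a set set \<Rightarrow> bool" where
  "simple_graph V E \<longleftrightarrow> finite V \<and> (\<forall>e\<in>E. e \<subseteq> V \<and> card e = 2)"

definition nbhd :: "'a set set \<Rightarrow> 'a \<Rightarrow> 'a set" where
  "nbhd E u = {v. {u, v} \<in> E}"


text \<open>A linear order \<open>(v\<^sub>1, \<dots>, v\<^sub>n)\<close> of \<open>V\<close> is the list enumerating \<open>V\<close> in that order.\<close>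

definition layout :: "'a set \<Rightarrow> 'a list \<Rightarrow> bool" where
  "layout V \<pi> \<longleftrightarrow> distinct \<pi> \<and> set \<pi> = V"

definition prefix_set :: "'a list \<Rightarrow> nat \<Rightarrow> 'a set" where
  "prefix_set \<pi> i = set (take i \<pi>)"

definition residual :: "'a set \<Rightarrow> 'a set set \<Rightarrow> 'a list \<Rightarrow> nat \<Rightarrow> 'a \<Rightarrow> 'a set" where
  "residual V E \<pi> i u = nbhd E u \<inter> (V - prefix_set \<pi> i)"

definition active_family :: "'a set \<Rightarrow> 'a set set \<Rightarrow> 'a list \<Rightarrow> nat \<Rightarrow> 'a set set" where
  "active_family V E \<pi> i = residual V E \<pi> i ` prefix_set \<pi> i - {{}}"

definition anw :: "'a set \<Rightarrow> 'a set set \<Rightarrow> 'a list \<Rightarrow> nat" where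
  "anw V E \<pi> = Max ((\<lambda>i. card (active_family V E \<pi> i)) ` {0..length \<pi>})"


record 'a config =
  born :: "'a set"
  live :: "'a set set"
  placed :: "'a set set"

definition initial :: "'a config" where
  "initial = \<lparr>born = {}, live = {}, placed = {}\<rparr>"

datatype 'a move =
    Birth "'a set"
  | Fold "'a set" "'a set"
  | Block "'a set" "'a set"
  | Clique "'a set"
  | Close "'a set"

definition pairs_between :: "'a set \<Rightarrow> 'a set \<Rightarrow> 'a set set" where
  "pairs_between X Y = {{x, y} | x y. x \<in> X \<and> y \<in> Y}"

definition pairs_inside :: "'a set \<Rightarrow> 'a set set" where
  "pairs_inside X = {{x, y} | x y. x \<in> X \<and> y \<in> X \<and> x \<noteq> y}"

fun legal :: "'a set \<Rightarrow> 'a set set \<Rightarrow> 'a config \<Rightarrow> 'a move \<Rightarrow> bool" where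
  "legal V E c (Birth S) \<longleftrightarrow> S \<noteq> {} \<and> S \<subseteq> V \<and> S \<inter> born c = {}"
| "legal V E c (Fold X Y) \<longleftrightarrow> X \<in> live c \<and> Y \<in> live c \<and> X \<noteq> Y"
| "legal V E c (Block X Y) \<longleftrightarrow> X \<in> live c \<and> Y \<in> live c \<and> X \<noteq> Y \<and>
     pairs_between X Y \<subseteq> E \<and> \<not> pairs_between X Y \<subseteq> placed c"
| "legal V E c (Clique X) \<longleftrightarrow> X \<in> live c \<and>
     pairs_inside X \<subseteq> E \<and> \<not> pairs_inside X \<subseteq> placed c"
| "legal V E c (Close X) \<longleftrightarrow> X \<in> live c \<and> (\<forall>e\<in>E. e \<inter> X \<noteq> {} \<longrightarrow> e \<in> placed c)"

fun exec :: "'a config \<Rightarrow> 'a move \<Rightarrow> 'a config" where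
  "exec c (Birth S) = c\<lparr>born := born c \<union> S, live := insert S (live c)\<rparr>"
| "exec c (Fold X Y) = c\<lparr>live := insert (X \<union> Y) (live c - {X, Y})\<rparr>"
| "exec c (Block X Y) = c\<lparr>placed := placed c \<union> pairs_between X Y\<rparr>"
| "exec c (Clique X) = c\<lparr>placed := placed c \<union> pairs_inside X\<rparr>"
| "exec c (Close X) = c\<lparr>live := live c - {X}\<rparr>"

text \<open>The first argument is the number of live cables before the move. A legal fold or close has
  a live cable available, so the subtraction on \<open>nat\<close> is never truncated in a play.\<close>

fun cost :: "nat \<Rightarrow> 'a move \<Rightarrow> nat" where
  "cost l (Birth S) = 2 * l + 1"
| "cost l (Fold X Y) = 2 * l - 1"
| "cost l (Block X Y) = 2 * l"
| "cost l (Clique X) = 2 * l"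
| "cost l (Close X) = 2 * l - 1"

definition run :: "'a config \<Rightarrow> 'a move list \<Rightarrow> 'a config" where
  "run c ms = foldl exec c ms"

definition play :: "'a set \<Rightarrow> 'a set set \<Rightarrow> 'a move list \<Rightarrow> bool" where
  "play V E ms \<longleftrightarrow> (\<forall>i<length ms. legal V E (run initial (take i ms)) (ms ! i))"

definition constructs :: "'a set \<Rightarrow> 'a set set \<Rightarrow> 'a move list \<Rightarrow> bool" where
  "constructs V E ms \<longleftrightarrow> play V E ms \<and>
     V \<subseteq> born (run initial ms) \<and> E \<subseteq> placed (run initial ms) \<and> live (run initial ms) = {}"

definition play_width :: "'a move list \<Rightarrow> nat" where
  "play_width ms =
     Max (insert 0 ((\<lambda>i. cost (card (live (run initial (take i ms)))) (ms ! i)) ` {0..<length ms}))"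

definition precedes :: "'a list \<Rightarrow> 'a \<Rightarrow> 'a \<Rightarrow> bool" where
  "precedes \<pi> u v \<longleftrightarrow> (\<exists>a b. a < b \<and> b < length \<pi> \<and> \<pi> ! a = u \<and> \<pi> ! b = v)"

definition birth_order :: "'a set \<Rightarrow> 'a move list \<Rightarrow> 'a list \<Rightarrow> bool" where
  "birth_order V ms \<pi> \<longleftrightarrow> layout V \<pi> \<and>
     (\<forall>i j S T. i < j \<and> j < length ms \<and> ms ! i = Birth S \<and> ms ! j = Birth T \<longrightarrow>
        (\<forall>u\<in>S. \<forall>v\<in>T. precedes \<pi> u v))"

text \<open>The live cables of a configuration are required to be pairwise disjoint nonempty sets of born
  vertices. This need not be built into the type, since legal moves preserve it.\<close>

definition cable_family :: "'a config \<Rightarrow> bool" where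
  "cable_family c \<longleftrightarrow> {} \<notin> live c \<and> pairwise disjnt (live c) \<and> \<Union> (live c) \<subseteq> born c"

lemma cable_family_initial: "cable_family initial"
  by (simp add: cable_family_def initial_def)

lemma cable_family_exec:
  assumes "cable_family c" and "legal V E c m"
  shows "cable_family (exec c m)"
  using assms by (cases m) (auto simp: cable_family_def pairwise_def disjnt_def; blast)+

lemma cable_family_run:
  assumes "play V E ms"
  shows "cable_family (run initial ms)"
  using assms
proof (induction ms rule: rev_induct)
  case Nil
  then show ?case by (simp add: run_def cable_family_initial)
next
  case (snoc m ms)
  have "play V E ms"
    unfolding play_def
  proof (intro allI impI)
    fix i assume "i < length ms"
    with snoc.prems show "legal V E (run initial (take i ms)) (ms ! i)"
      unfolding play_def by (auto simp: nth_append dest: spec[of _ i])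
  qed
  moreover have "legal V E (run initial ms) m"
    using snoc.prems unfolding play_def by (auto simp: nth_append dest: spec[of _ "length ms"])
  ultimately show ?case
    using snoc.IH cable_family_exec by (fastforce simp: run_def)
qed

end

theory Submission
  imports Defs
begin

text \<open>Vertices of one cable stay together until that cable is closed, so they acquire the same
  neighbours from then on. Cut the birth order in front of a vertex \<open>v\<close>. Just after the birth of
  \<open>v\<close>, no edge across the cut is placed and every vertex that is no longer in a live cable has
  empty residual, so the active family has at most as many members as there are live cables. If the
  next move is a birth, block or clique, its cost is at least twice that number. If it is a fold or
  a close, which places no edge, then the same count applies after it, where one cable fewer is
  live.\<close>

section \<open>Bookkeeping of plays: births, live cables and placed edges\<close>

lemma run_snoc [simp]: "run c (ms @ [m]) = exec (run c ms) m"
  by (simp add: run_def)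

lemma play_snoc: "play V E (ms @ [m]) \<longleftrightarrow> play V E ms \<and> legal V E (run initial ms) m"
  by (auto simp: play_def nth_append less_Suc_eq)

lemma play_appendD: "play V E (as @ bs) \<Longrightarrow> play V E as"
  by (induction bs rule: rev_induct) (auto simp: play_snoc simp flip: append_assoc)

lemma cost_le_play_width:
  "cost (card (live (run initial as))) m \<le> play_width (as @ m # bs)"
proof -
  let ?ms = "as @ m # bs"
  have "cost (card (live (run initial as))) m
      = (\<lambda>i. cost (card (live (run initial (take i ?ms)))) (?ms ! i)) (length as)"
    by simp
  moreover have "length as \<in> {0..<length ?ms}"
    by simp
  ultimately show ?thesis
    unfolding play_width_def by (intro Max_ge) (blast | simp)+
qed

lemma born_run: "born (run initial ms) = \<Union> {S. Birth S \<in> set ms}"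
proof (induction ms rule: rev_induct)
  case Nil
  then show ?case by (simp add: run_def initial_def)
next
  case (snoc m ms)
  then show ?case by (cases m) auto
qed

lemma finite_live_run: "finite (live (run initial ms))"
proof (induction ms rule: rev_induct)
  case Nil
  then show ?case by (simp add: run_def initial_def)
next
  case (snoc m ms)
  then show ?case by (cases m) auto
qed

text \<open>Blocks and cliques act on live cables, whose vertices are all born. Hence no edge at an
  unborn vertex can have been placed.\<close>

lemma placed_run_subset_born:
  assumes "play V E ms"
  shows "\<Union> (placed (run initial ms)) \<subseteq> born (run initial ms)"
  using assms
proof (induction ms rule: rev_induct)
  case Nil
  then show ?case by (simp add: run_def initial_def)
next
  case (snoc m ms)
  have "cable_family (run initial ms)"
    using snoc.prems cable_family_run play_snoc by blast
  with snoc show ?case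
    by (cases m) (auto simp: play_snoc cable_family_def pairs_between_def pairs_inside_def)
qed

text \<open>A born vertex leaves the live cables only when its cable is closed, which requires all
  its edges to be placed already; placed edges stay placed.\<close>

lemma closed_run_placed:
  assumes "play V E ms"
    and "u \<in> born (run initial ms)" and "u \<notin> \<Union> (live (run initial ms))"
    and "e \<in> E" and "u \<in> e"
  shows "e \<in> placed (run initial ms)"
  using assms
proof (induction ms rule: rev_induct)
  case Nil
  then show ?case by (simp add: run_def initial_def)
next
  case (snoc m ms)
  then show ?case by (cases m) (auto simp: play_snoc)
qed

section \<open>Twin vertices within a live cable\<close>

lemma cable_family_eq:
  assumes "cable_family c" and "X \<in> live c" and "Y \<in> live c" and "u \<in> X" and "u \<in> Y"
  shows "X = Y"
  using assms unfolding cable_family_def pairwise_def disjnt_def by blast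

text \<open>Follow the remaining moves \<open>bs\<close> until \<open>{u, v}\<close> is placed.
  Until then the cable of \<open>u\<close> cannot be closed, so \<open>u'\<close> stays with
  \<open>u\<close>. The block or clique that places \<open>{u, v}\<close> covers
  \<open>{u', v}\<close> as well, and its legality puts this pair into \<open>E\<close>. The
  condition \<open>v \<noteq> u'\<close> keeps the pair from degenerating in the clique
  case.\<close>

lemma twins_for_unplaced_edges:
  assumes "play V E (as @ bs)" and "E \<subseteq> placed (run initial (as @ bs))"
    and "X \<in> live (run initial as)" and "u \<in> X" and "u' \<in> X" and "v \<noteq> u'"
    and "{u, v} \<in> E" and "{u, v} \<notin> placed (run initial as)"
  shows "{u', v} \<in> E"
  using assms
proof (induction bs arbitrary: as X)
  case Nil
  then show ?case by auto
next
  case (Cons m bs)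
  let ?c = "run initial as"
  \<comment> \<open>The induction hypothesis, with \<open>m\<close> moved from \<open>bs\<close> to
    the end of \<open>as\<close>: it applies if \<open>u\<close> and \<open>u'\<close> share a live
    cable after \<open>m\<close> and the edge is still unplaced.\<close>
  have step: "{u', v} \<in> E"
    if "Y \<in> live (exec ?c m)" "u \<in> Y" "u' \<in> Y" "{u, v} \<notin> placed (exec ?c m)" for Y
    using Cons.IH[of "as @ [m]" Y] Cons.prems that by simp
  have pl: "play V E (as @ [m])"
    using Cons.prems(1) play_appendD[of V E "as @ [m]" bs] by simp
  then have legal: "legal V E ?c m" and cf: "cable_family ?c"
    using cable_family_run play_snoc by blast+
  \<comment> \<open>By disjointness, any cable that \<open>m\<close> acts on and that contains
    \<open>u\<close> also contains \<open>u'\<close>.\<close>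
  have same: "Z = X" if "Z \<in> live ?c" "u \<in> Z" for Z
    using cable_family_eq[OF cf that(1) Cons.prems(3) that(2) Cons.prems(4)] .
  show ?case
  proof (cases m)
    case (Birth S)
    then show ?thesis using step[of X] Cons.prems by simp
  next
    case (Fold Y Z)
    show ?thesis
    proof (cases "X \<in> {Y, Z}")
      case True
      then show ?thesis using step[of "Y \<union> Z"] Cons.prems Fold by auto
    next
      case False
      then show ?thesis using step[of X] Cons.prems Fold by simp
    qed
  next
    case (Block Y Z)
    show ?thesis
    proof (cases "{u, v} \<in> pairs_between Y Z")
      case True
      then have "u \<in> Y \<and> v \<in> Z \<or> u \<in> Z \<and> v \<in> Y"
        unfolding pairs_between_def by (auto simp: doubleton_eq_iff)
      then have "u' \<in> Y \<and> v \<in> Z \<or> u' \<in> Z \<and> v \<in> Y"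
        using same legal Block Cons.prems(5) by auto
      then have "{u', v} \<in> pairs_between Y Z"
        unfolding pairs_between_def by blast
      then show ?thesis using legal Block by auto
    next
      case False
      then show ?thesis using step[of X] Cons.prems Block by simp
    qed
  next
    case (Clique Y)
    show ?thesis
    proof (cases "{u, v} \<in> pairs_inside Y")
      case True
      then have "u \<in> Y" "v \<in> Y"
        unfolding pairs_inside_def by (auto simp: doubleton_eq_iff)
      then have "u' \<in> Y"
        using same legal Clique Cons.prems(5) by auto
      then have "{u', v} \<in> pairs_inside Y"
        using \<open>v \<in> Y\<close> Cons.prems(6) unfolding pairs_inside_def by blast
      then show ?thesis using legal Clique by auto
    next
      case False
      then show ?thesis using step[of X] Cons.prems Clique by simp
    qed
  next
    case (Close Y)
    then have "X \<noteq> Y"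
      using legal Cons.prems by auto
    then show ?thesis using step[of X] Cons.prems Close by simp
  qed
qed

text \<open>An unplaced edge across the cut keeps its prefix end in a live cable, and prefix
  vertices sharing a cable are twins across the cut. So each live cable accounts for at most one
  nonempty residual.\<close>

lemma card_active_le_card_live:
  assumes play: "play V E (as @ bs)" and E: "E \<subseteq> placed (run initial (as @ bs))"
    and born: "prefix_set \<pi> i \<subseteq> born (run initial as)"
    and unplaced: "\<And>u v. v \<in> V - prefix_set \<pi> i \<Longrightarrow> {u, v} \<notin> placed (run initial as)"
  shows "card (active_family V E \<pi> i) \<le> card (live (run initial as))"
proof -
  let ?c = "run initial as" and ?R = "residual V E \<pi> i"
  \<comment> \<open>On cables that miss the prefix the value of \<open>rep\<close> is arbitrary;
    this can only enlarge the image that serves as an upper bound.\<close>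
  define rep where "rep X = (SOME u. u \<in> X \<inter> prefix_set \<pi> i)" for X
  have R_mono: "?R u \<subseteq> ?R u'"
    if "X \<in> live ?c" "u \<in> X" "u' \<in> X" "u' \<in> prefix_set \<pi> i" for X u u'
  proof
    fix v assume "v \<in> ?R u"
    then have v: "{u, v} \<in> E" "v \<in> V - prefix_set \<pi> i"
      by (auto simp: residual_def nbhd_def)
    with that(4) have "v \<noteq> u'" by blast
    then show "v \<in> ?R u'"
      using twins_for_unplaced_edges[OF play E that(1-3) _ v(1) unplaced[OF v(2)]] v(2)
      by (simp add: residual_def nbhd_def)
  qed
  have "active_family V E \<pi> i \<subseteq> (\<lambda>X. ?R (rep X)) ` live ?c"
  proof
    fix A assume "A \<in> active_family V E \<pi> i"
    then obtain u where u: "u \<in> prefix_set \<pi> i" "A = ?R u" "A \<noteq> {}"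
      by (auto simp: active_family_def)
    then obtain v where v: "{u, v} \<in> E" "v \<in> V - prefix_set \<pi> i"
      by (auto simp: residual_def nbhd_def)
    \<comment> \<open>If \<open>u\<close> were in no live cable, all its edges would be placed,
      including \<open>{u, v}\<close>.\<close>
    then obtain X where X: "X \<in> live ?c" "u \<in> X"
      using closed_run_placed[OF play_appendD[OF play] _ _ v(1)] unplaced[OF v(2)] born u(1)
      by blast
    then have "rep X \<in> X \<inter> prefix_set \<pi> i"
      using u(1) someI[of "\<lambda>u. u \<in> X \<inter> prefix_set \<pi> i" u] unfolding rep_def by blast
    then have "?R u = ?R (rep X)"
      using R_mono X u(1) by blast
    then show "A \<in> (\<lambda>X. ?R (rep X)) ` live ?c"
      using X u(2) by blast
  qed
  then show ?thesis
    by (meson card_image_le card_mono finite_imageI finite_live_run le_trans)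
qed

section \<open>Cuts of the birth order\<close>

lemma precedes_in_prefix_iff:
  assumes "distinct \<pi>" and "i < length \<pi>"
  shows "precedes \<pi> u (\<pi> ! i) \<longleftrightarrow> u \<in> prefix_set \<pi> i"
  using assms
  by (auto simp: precedes_def prefix_set_def in_set_conv_nth nth_eq_iff_index_eq)
    (metis nth_take)

lemma precedes_asym:
  assumes "distinct \<pi>" and "precedes \<pi> u v"
  shows "\<not> precedes \<pi> v u"
proof
  assume "precedes \<pi> v u"
  then obtain a b where ab: "a < b" "b < length \<pi>" "\<pi> ! a = v" "\<pi> ! b = u"
    by (auto simp: precedes_def)
  obtain k l where kl: "k < l" "l < length \<pi>" "\<pi> ! k = u" "\<pi> ! l = v"
    using assms(2) by (auto simp: precedes_def)
  have "b = k" "a = l"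
    using ab kl assms(1) by (metis nth_eq_iff_index_eq less_trans)+
  then show False using ab(1) kl(1) by simp
qed

lemma birth_order_precedes:
  assumes "birth_order V (as @ Birth S # bs @ Birth T # cs) \<pi>" and "u \<in> S" and "v \<in> T"
  shows "precedes \<pi> u v"
proof -
  let ?ms = "as @ Birth S # bs @ Birth T # cs"
  have "length as < length as + Suc (length bs)" "length as + Suc (length bs) < length ?ms"
    "?ms ! length as = Birth S" "?ms ! (length as + Suc (length bs)) = Birth T"
    by (simp_all add: nth_append)
  then show ?thesis
    using assms unfolding birth_order_def by blast
qed

text \<open>The cut may split the birth group \<open>S\<close> of \<open>\<pi> ! i\<close>: the
  prefix contains everything born before \<open>S\<close>, possibly part of \<open>S\<close>, and
  nothing born later. The count is therefore made after the birth of \<open>S\<close> and charged to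
  the next move \<open>m\<close>.\<close>

lemma card_active_le:
  assumes con: "constructs V E ms" and bo: "birth_order V ms \<pi>" and i: "i < length \<pi>"
  shows "2 * card (active_family V E \<pi> i) \<le> play_width ms"
proof -
  let ?v = "\<pi> ! i" and ?P = "prefix_set \<pi> i" and ?A = "active_family V E \<pi> i"
  have dist: "distinct \<pi>" and V: "set \<pi> = V"
    using bo by (auto simp: birth_order_def layout_def)
  have play: "play V E ms" and VB: "V \<subseteq> born (run initial ms)"
    and E: "E \<subseteq> placed (run initial ms)" and closed: "live (run initial ms) = {}"
    using con by (auto simp: constructs_def)
  have PV: "?P \<subseteq> V"
    using V set_take_subset unfolding prefix_set_def by metis
  obtain S where S: "Birth S \<in> set ms" "?v \<in> S"
    using VB V i born_run[of ms] nth_mem by blast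
  then obtain as bs where ms: "ms = as @ Birth S # bs"
    by (meson split_list)
  let ?c = "run initial as" and ?c1 = "run initial (as @ [Birth S])"
  have old: "born ?c \<subseteq> ?P"
  proof
    fix u assume "u \<in> born ?c"
    then obtain T where T: "Birth T \<in> set as" "u \<in> T"
      by (auto simp: born_run)
    then obtain xs ys where "as = xs @ Birth T # ys"
      by (meson split_list)
    then have "precedes \<pi> u ?v"
      using birth_order_precedes[of V xs T ys S bs \<pi>] bo ms T S by simp
    then show "u \<in> ?P"
      using precedes_in_prefix_iff dist i by metis
  qed
  have new: "?P \<subseteq> born ?c1"
  proof
    fix u assume u: "u \<in> ?P"
    then obtain T where T: "Birth T \<in> set ms" "u \<in> T"
      using PV VB born_run[of ms] by blast
    have "Birth T \<notin> set bs"
    proof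
      assume "Birth T \<in> set bs"
      then obtain xs ys where "bs = xs @ Birth T # ys"
        by (meson split_list)
      then have "precedes \<pi> ?v u"
        using birth_order_precedes[of V as S xs T ys \<pi>] bo ms T S by simp
      then show False
        using u precedes_in_prefix_iff[OF dist i] precedes_asym[OF dist] by blast
    qed
    then show "u \<in> born ?c1"
      using T ms by (auto simp: born_run)
  qed
  \<comment> \<open>A vertex outside the prefix is unborn in \<open>?c\<close>, and the birth of
    \<open>S\<close> places no edge.\<close>
  have unplaced: "{u, v} \<notin> placed ?c" if "v \<in> V - ?P" for u v
    using placed_run_subset_born[of V E as] play_appendD play ms old that by blast
  \<comment> \<open>The play must still dispose of the cable \<open>S\<close>, so a next move
    exists.\<close>
  have "S \<in> live ?c1"
    by simp
  with closed ms obtain m cs where bs: "bs = m # cs"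
    by (cases bs) auto
  define c1 where "c1 = ?c1"
  define c2 where "c2 = run initial (as @ [Birth S, m])"
  have c2: "c2 = exec c1 m"
    using run_snoc[of initial "as @ [Birth S]" m] by (simp add: c1_def c2_def)
  have cost: "cost (card (live c1)) m \<le> play_width ms"
    using cost_le_play_width[of "as @ [Birth S]" m cs] ms bs by (simp add: c1_def)
  have legal: "legal V E c1 m"
    using play play_appendD[of V E "(as @ [Birth S]) @ [m]" cs]
      play_snoc[of V E "as @ [Birth S]" m] ms bs by (simp add: c1_def)
  have A1: "card ?A \<le> card (live c1)"
    using card_active_le_card_live[of V E "as @ [Birth S]" bs \<pi> i] play E ms new unplaced
    by (simp add: c1_def)
  \<comment> \<open>For fold and close, whose cost is only \<open>2 * l - 1\<close>: counting after
    the move gains one cable, and \<open>2 * (l - 1) \<le> 2 * l - 1\<close>.\<close>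
  have A2: "card ?A \<le> card (live c2)"
    if "born c2 = born c1" "placed c2 = placed c1"
    using card_active_le_card_live[of V E "as @ [Birth S, m]" cs \<pi> i] play E ms bs new unplaced
      that by (simp add: c1_def flip: c2_def)
  have fin: "finite (live c1)"
    unfolding c1_def by (rule finite_live_run)
  show ?thesis
  proof (cases m)
    case (Fold X Y)
    have live: "{X, Y} \<subseteq> live c1" "X \<noteq> Y"
      using legal Fold by auto
    then have "card (live c1 - {X, Y}) = card (live c1) - 2"
      by (simp add: card_Diff_subset)
    moreover have "2 \<le> card (live c1)"
      using live fin card_mono[of "live c1" "{X, Y}"] by simp
    moreover have "card (live c2) \<le> Suc (card (live c1 - {X, Y}))"
      unfolding c2 Fold by (simp add: card_insert_if fin)
    ultimately have "Suc (card (live c2)) \<le> card (live c1)"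
      by linarith
    with A2 cost show ?thesis
      unfolding c2 Fold by simp
  next
    case (Close X)
    have "X \<in> live c1"
      using legal Close by simp
    then have "Suc (card (live c2)) = card (live c1)"
      unfolding c2 Close using card_Suc_Diff1[OF fin] by (simp del: card_Diff_singleton)
    with A2 cost show ?thesis
      unfolding c2 Close by simp
  \<comment> \<open>Birth, block and clique cost at least twice the number of live cables.\<close>
  qed (use A1 cost in auto)
qed

theorem proposition3p4:
  fixes V :: "'a set" and E :: "'a set set" and ms :: "'a move list"
    and w :: nat and \<pi> :: "'a list"
  assumes "simple_graph V E"
    and "constructs V E ms"
    and "play_width ms = w"
    and "birth_order V ms \<pi>"
  shows "layout V \<pi> \<and> anw V E \<pi> \<le> w div 2"
proof
  show lay: "layout V \<pi>"
    using assms(4) by (simp add: birth_order_def)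
  have "card (active_family V E \<pi> i) \<le> w div 2" if "i \<le> length \<pi>" for i
  proof (cases "i < length \<pi>")
    case True
    then show ?thesis
      using card_active_le[OF assms(2,4)] assms(3) by fastforce
  next
    \<comment> \<open>At \<open>i = length \<pi>\<close> the prefix is all of \<open>V\<close>, so
      every residual is empty.\<close>
    case False
    with that have "active_family V E \<pi> i = {}"
      using lay by (auto simp: active_family_def residual_def prefix_set_def layout_def)
    then show ?thesis by simp
  qed
  then show "anw V E \<pi> \<le> w div 2"
    unfolding anw_def by (intro Max.boundedI) auto
qed

end
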